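(* Let $A\in\mathbb{R}^{m\times p}$, $B\in\mathbb{R}^{q\times n}$ and $C\in\mathbb{R}^{m\times n}$ be such that the matrix equation $AXB=C$ is consistent. Assume that $0<\alpha<\frac{2}{\|B\|_2^2}$. Let $\{X^k\}_{k=0}^\infty$ be the sequence generated by the ME-MWRBK method (described in the context) from an initial matrix $X^0\in\mathbb{R}^{p\times q}$ with $\mathrm{vec}(X^0)\in R(B\otimes A^T)$. Then $\{X^k\}$ converges to the unique least-norm solution $X_*=A^+CB^+$ of $AXB=C$. Moreover, for $k=0,1,2,\ldots$, $$\|X^{k+1}-X_*\|_F^2\le\prod_{l=0}^{k}\widetilde\rho_l\,\|X^0-X_*\|_F^2,$$ where $\widetilde\rho_0=1-\frac{(2\alpha-\alpha^2\|B\|_2^2)\|B\|_F^2}{\kappa_{F,2}^2(B^T\otimes A)}$ and $\widetilde\rho_l=1-\frac{2\alpha-\alpha^2\|B\|_2^2}{\gamma_l}\sigma_{\min}^2(A)\sigma_{\min}^2(B)$ for $l=1,2,\ldots,k$, with $\gamma_l=\|A\|_F^2-\sum_{i\in\Omega_l}\|A_{i,:}\|_2^2$ and $\Omega_l=\{i\in[m] : \|R^l_{i,:}\|_2^2=0\}$, $R^l=C-AX^lB$.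
   Context: Notation: for a real matrix $M$, $M^T$ is the transpose, $M^+$ the Moore–Penrose inverse, $R(M)$ the range (column space), $\|M\|_2$ the spectral norm (Euclidean norm for vectors), $\|M\|_F$ the Frobenius norm, $M_{i,:}$ the $i$-th row, $\sigma_{\min}(M)=1/\|M^+\|_2$ the smallest nonzero singular value; $\otimes$ is the Kronecker product; $\mathrm{vec}(\cdot)$ stacks the columns of a matrix; $[m]=\{1,\ldots,m\}$; $\kappa_{F,2}(M):=\|M\|_F\|M^+\|_2=\|M\|_F/\sigma_{\min}(M)$. The least-norm solution is the solution of $AXB=C$ of minimal Frobenius norm. All rows of $A$ are nonzero and $B\ne0$. ME-MWRBK method: given $X^0$, for $k=0,1,2,\ldots$ until convergence, put $R^k=C-AX^kB$, pick any index $$i_k\in\mathcal{G}_k=\left\{i\in[m] : \frac{\|R^k_{i,:}\|_2^2}{\|A_{i,:}\|_2^2}=\max_{1\le j\le m}\frac{\|R^k_{j,:}\|_2^2}{\|A_{j,:}\|_2^2}\right\},$$ and set $X^{k+1}=X^k+\frac{\alpha}{\|A_{i_k,:}\|_2^2}A_{i_k,:}^T\left(C_{i_k,:}-A_{i_k,:}X^kB\right)B^T$. The iteration stops once $R^k=0$ (the sequence is then taken constant from that point on); the quantities $\gamma_l$ and the bounds involving them are understood for iterations with $R^l\neq0$. *)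

theory Defs
  imports "HOL-Analysis.Analysis"
begin

text \<open>
  An \<open>m \<times> n\<close> matrix is an element of \<open>real^'n^'m\<close>, so the library \<^const>\<open>norm\<close> of a
  matrix is its Frobenius norm (lemma below), and limits in the matrix space are
  taken with respect to it. The spectral norm is the operator norm of \<open>(*v) M\<close>.
\<close>

abbreviation frob_norm :: "real^'n^'m \<Rightarrow> real" where
  "frob_norm M \<equiv> norm M"

lemma frob_norm_eq: "frob_norm (M :: real^'n^'m) = sqrt (\<Sum>i\<in>UNIV. \<Sum>j\<in>UNIV. (M $ i $ j)\<^sup>2)"
  by (simp add: norm_vec_def L2_set_def sum_nonneg)

definition spectral_norm :: "real^'n^'m \<Rightarrow> real" where
  "spectral_norm M = onorm (\<lambda>v. M *v v)"

definition matrix_range :: "real^'n^'m \<Rightarrow> (real^'m) set" where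
  "matrix_range M = range (\<lambda>v. M *v v)"

text \<open>The four Penrose conditions, which have exactly one solution for every \<open>M\<close>.\<close>

definition is_mp_inverse :: "real^'n^'m \<Rightarrow> real^'m^'n \<Rightarrow> bool" where
  "is_mp_inverse M P \<longleftrightarrow>
     M ** P ** M = M \<and> P ** M ** P = P \<and>
     transpose (M ** P) = M ** P \<and> transpose (P ** M) = P ** M"

definition mp_inverse :: "real^'n^'m \<Rightarrow> real^'m^'n" where
  "mp_inverse M = (THE P. is_mp_inverse M P)"

text \<open>The smallest nonzero singular value, for \<open>M \<noteq> 0\<close>.\<close>

definition sigma_min :: "real^'n^'m \<Rightarrow> real" where
  "sigma_min M = 1 / spectral_norm (mp_inverse M)"

definition kappa_F2 :: "real^'n^'m \<Rightarrow> real" where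
  "kappa_F2 M = frob_norm M * spectral_norm (mp_inverse M)"

text \<open>
  Kronecker products and vectorizations are indexed by pairs: the first component is the
  block index and the second the index inside the block. In \<open>vec_cols X\<close> the block index is
  therefore the column of \<open>X\<close>, so that the columns are stacked.
\<close>

definition kronecker :: "real^'b^'a \<Rightarrow> real^'d^'c \<Rightarrow> real^('b \<times> 'd)^('a \<times> 'c)" where
  "kronecker M N = (\<chi> r s. M $ fst r $ fst s * N $ snd r $ snd s)"

definition vec_cols :: "real^'q^'p \<Rightarrow> real^('q \<times> 'p)" where
  "vec_cols X = (\<chi> r. X $ snd r $ fst r)"

lemma vec_cols_triple_product:
  fixes A :: "real^'p^'m" and X :: "real^'q^'p" and B :: "real^'n^'q"
  shows "vec_cols (A ** X ** B) = kronecker (transpose B) A *v vec_cols X"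
proof -
  have "(\<Sum>k\<in>UNIV. (\<Sum>l\<in>UNIV. A $ i $ l * X $ l $ k) * B $ k $ j) =
      (\<Sum>r\<in>UNIV. B $ fst r $ j * A $ i $ snd r * X $ snd r $ fst r)" for i j
    by (simp add: UNIV_Times_UNIV[symmetric] sum.cartesian_product case_prod_beta
        sum_distrib_left sum_distrib_right mult_ac del: UNIV_Times_UNIV)
  then show ?thesis
    by (simp add: vec_eq_iff vec_cols_def kronecker_def transpose_def
        matrix_matrix_mult_def matrix_vector_mult_def)
qed

definition is_least_norm_solution ::
    "real^'p^'m \<Rightarrow> real^'n^'q \<Rightarrow> real^'n^'m \<Rightarrow> real^'q^'p \<Rightarrow> bool" where
  "is_least_norm_solution A B C X \<longleftrightarrow>
     A ** X ** B = C \<and> (\<forall>Y. A ** Y ** B = C \<longrightarrow> frob_norm X \<le> frob_norm Y)"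

definition residual ::
    "real^'p^'m \<Rightarrow> real^'n^'q \<Rightarrow> real^'n^'m \<Rightarrow> real^'q^'p \<Rightarrow> real^'n^'m" where
  "residual A B C X = C - A ** X ** B"

definition greedy_set :: "real^'p^'m \<Rightarrow> real^'n^'m \<Rightarrow> 'm set" where
  "greedy_set A R =
     {i. (norm (row i R))\<^sup>2 / (norm (row i A))\<^sup>2 =
         Max (range (\<lambda>j. (norm (row j R))\<^sup>2 / (norm (row j A))\<^sup>2))}"

text \<open>The term \<open>C\<^sub>i\<^sub>,\<^sub>: - A\<^sub>i\<^sub>,\<^sub>: X B\<close> is a row vector, hence a \<open>1 \<times> n\<close> matrix.\<close>

definition mwrbk_step ::
    "real^'p^'m \<Rightarrow> real^'n^'q \<Rightarrow> real^'n^'m \<Rightarrow> real \<Rightarrow> 'm \<Rightarrow> real^'q^'p \<Rightarrow> real^'q^'p" where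
  "mwrbk_step A B C \<alpha> i X =
     X + (\<alpha> / (norm (row i A))\<^sup>2) *\<^sub>R
       (transpose (rowvector (row i A) :: real^'p^1) **
        ((rowvector (row i C) :: real^'n^1) - (rowvector (row i A) :: real^'p^1) ** X ** B) **
        transpose B)"

text \<open>
  A relation rather than a function, since the row index is an arbitrary element of the
  greedy set in every iteration. A terminated run is continued as a constant sequence.
\<close>

definition me_mwrbk_sequence ::
    "real^'p^'m \<Rightarrow> real^'n^'q \<Rightarrow> real^'n^'m \<Rightarrow> real \<Rightarrow> (nat \<Rightarrow> real^'q^'p) \<Rightarrow> bool" where
  "me_mwrbk_sequence A B C \<alpha> X \<longleftrightarrow>
     (\<forall>k. if residual A B C (X k) = 0 then X (Suc k) = X k
          else \<exists>i\<in>greedy_set A (residual A B C (X k)). X (Suc k) = mwrbk_step A B C \<alpha> i (X k))"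

definition zero_rows :: "real^'n^'m \<Rightarrow> 'm set" where
  "zero_rows R = {i. (norm (row i R))\<^sup>2 = 0}"

definition gamma_coeff :: "real^'p^'m \<Rightarrow> real^'n^'m \<Rightarrow> real" where
  "gamma_coeff A R = (frob_norm A)\<^sup>2 - (\<Sum>i\<in>zero_rows R. (norm (row i A))\<^sup>2)"

definition rho_coeff ::
    "real^'p^'m \<Rightarrow> real^'n^'q \<Rightarrow> real^'n^'m \<Rightarrow> real \<Rightarrow> (nat \<Rightarrow> real^'q^'p) \<Rightarrow> nat \<Rightarrow> real" where
  "rho_coeff A B C \<alpha> X l =
     (if l = 0
      then 1 - ((2 * \<alpha> - \<alpha>\<^sup>2 * (spectral_norm B)\<^sup>2) * (frob_norm B)\<^sup>2)
                 / (kappa_F2 (kronecker (transpose B) A))\<^sup>2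
      else 1 - (2 * \<alpha> - \<alpha>\<^sup>2 * (spectral_norm B)\<^sup>2) / gamma_coeff A (residual A B C (X l))
                 * (sigma_min A)\<^sup>2 * (sigma_min B)\<^sup>2)"

end

(* Put E = X - X_*. A step in row i changes E by a multiple of a r B^T, where a^T = A_i and r is the
   i-th row of the residual R = -A E B; expanding the square gives
   |E'|^2 <= |E|^2 - (2 alpha - alpha^2 |B|_2^2) |R_i|^2 / |A_i|^2.
   The greedy choice makes the last ratio at least |R|^2 / gamma, where gamma may be replaced by
   |A|_F^2 and is the sum of |A_j|^2 over the nonzero rows of R. Since X^0, X_* and all the increments
   have the form A^T W B^T, the error does too, so E = A^+ (A E B) B^+ bounds |R| = |A E B|
   from below by sigma_min(A) sigma_min(B) |E|; at step 0 the pseudoinverse of B^T (x) A is used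
   instead. The same form makes X_* orthogonal to X - X_* for every solution X, so that it is the
   least-norm solution. *)
theory Submission
  imports Defs
begin

section \<open>Matrix algebra and the Frobenius inner product\<close>

lemma matrix_mult_diff_right: "(M :: real^'b^'a) ** (Y - Z) = M ** Y - M ** Z"
  by (simp add: matrix_matrix_mult_def vec_eq_iff algebra_simps sum_subtractf)

lemma matrix_mult_diff_left: "(Y - Z :: real^'b^'a) ** M = Y ** M - Z ** M"
  by (simp add: matrix_matrix_mult_def vec_eq_iff algebra_simps sum_subtractf)

lemma matrix_mult_zero_right [simp]: "(M :: real^'b^'a) ** 0 = 0"
  by (simp add: matrix_matrix_mult_def vec_eq_iff)

lemma matrix_mult_zero_left [simp]: "(0 :: real^'b^'a) ** M = 0"
  by (simp add: matrix_matrix_mult_def vec_eq_iff)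

lemma inner_matrix: "(Y :: real^'b^'a) \<bullet> Z = (\<Sum>i\<in>UNIV. \<Sum>j\<in>UNIV. Y $ i $ j * Z $ i $ j)"
  by (simp add: inner_vec_def)

lemma norm_matrix_sq: "(norm (Y :: real^'b^'a))\<^sup>2 = (\<Sum>i\<in>UNIV. (norm (row i Y))\<^sup>2)"
  by (simp add: norm_vec_def[of Y] row_def L2_set_def sum_nonneg)

lemma inner_transpose: "transpose Y \<bullet> transpose Z = (Y :: real^'b^'a) \<bullet> Z"
  unfolding inner_matrix transpose_def by (simp, rule sum.swap)

lemma norm_transpose [simp]: "norm (transpose (Y :: real^'b^'a)) = norm Y"
  by (simp add: norm_eq_sqrt_inner inner_transpose)

lemma inner_matrix_mult_right: "((Y :: real^'b^'a) ** M) \<bullet> Z = Y \<bullet> (Z ** transpose M)"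
proof -
  have "(\<Sum>j\<in>UNIV. (\<Sum>k\<in>UNIV. Y $ i $ k * M $ k $ j) * Z $ i $ j) =
      (\<Sum>k\<in>UNIV. Y $ i $ k * (\<Sum>j\<in>UNIV. Z $ i $ j * M $ k $ j))" for i
    unfolding sum_distrib_left sum_distrib_right
    by (subst sum.swap) (simp add: mult_ac)
  then show ?thesis
    by (simp add: inner_matrix matrix_matrix_mult_def transpose_def)
qed

lemma inner_matrix_mult_left: "((M :: real^'b^'a) ** Y) \<bullet> Z = Y \<bullet> (transpose M ** Z)"
proof -
  have "(M ** Y) \<bullet> Z = (transpose Y ** transpose M) \<bullet> transpose Z"
    unfolding matrix_transpose_mul[symmetric] inner_transpose ..
  also have "\<dots> = transpose Y \<bullet> transpose (transpose M ** Z)"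
    by (simp add: inner_matrix_mult_right matrix_transpose_mul)
  finally show ?thesis
    by (simp only: inner_transpose)
qed

lemma inner_matrix_mult_both:
  "((M :: real^'b^'a) ** Y ** N) \<bullet> Z = Y \<bullet> (transpose M ** Z ** transpose N)"
  by (subst inner_matrix_mult_right, subst inner_matrix_mult_left) (simp add: matrix_mul_assoc)

text \<open>Moving \<open>M\<close> across the inner product turns \<open>|M ** Z|^2\<close> into
  \<open>Z\<close> paired with the matrix assumed to vanish.\<close>

lemma gram_mult_eq_0:
  fixes M :: "real^'b^'a"
  assumes "transpose M ** M ** Z = 0"
  shows "M ** Z = 0"
proof -
  have "(M ** Z) \<bullet> (M ** Z) = Z \<bullet> (transpose M ** M ** Z)"
    by (subst inner_matrix_mult_left) (simp add: matrix_mul_assoc)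
  with assms show ?thesis by simp
qed

section \<open>Spectral norm\<close>

lemma spectral_norm_bound: "norm ((M :: real^'b^'a) *v v) \<le> spectral_norm M * norm v"
  unfolding spectral_norm_def by (rule onorm) simp

lemma spectral_norm_nonneg [simp]: "0 \<le> spectral_norm (M :: real^'b^'a)"
  unfolding spectral_norm_def by (rule onorm_pos_le) simp

lemma spectral_norm_pos:
  assumes "(M :: real^'b^'a) \<noteq> 0"
  shows "0 < spectral_norm M"
proof -
  have "\<not> (\<forall>v. M *v v = 0)"
    using assms by (metis matrix_eq matrix_vector_mult_0)
  then show ?thesis
    unfolding spectral_norm_def by (subst onorm_pos_lt) auto
qed

text \<open>For \<open>w = transpose M *v v\<close>, Cauchy-Schwarz bounds \<open>|w|^2\<close>, the
  pairing of \<open>v\<close> with \<open>M *v w\<close>; one factor \<open>|w|\<close> then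
  cancels. Equality follows by applying this to \<open>transpose M\<close> as well.\<close>

lemma spectral_norm_transpose_le: "spectral_norm (transpose M) \<le> spectral_norm (M :: real^'b^'a)"
  unfolding spectral_norm_def[of "transpose M"]
proof (rule onorm_le)
  fix v :: "real^'a"
  let ?w = "transpose M *v v"
  have "norm ?w * norm ?w = ?w \<bullet> ?w"
    by (simp only: power2_norm_eq_inner flip: power2_eq_square)
  also have "\<dots> = v \<bullet> (M *v ?w)"
    by (simp add: dot_lmul_matrix)
  also have "\<dots> \<le> norm v * (spectral_norm M * norm ?w)"
    by (rule order_trans[OF norm_cauchy_schwarz])
      (intro mult_left_mono spectral_norm_bound norm_ge_zero)
  finally have "norm ?w * norm ?w \<le> (spectral_norm M * norm v) * norm ?w"
    by (simp add: mult_ac)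
  then show "norm ?w \<le> spectral_norm M * norm v"
    by (cases "norm ?w = 0") (simp_all add: mult_le_cancel_right)
qed

lemma spectral_norm_transpose [simp]:
  "spectral_norm (transpose M) = spectral_norm (M :: real^'b^'a)"
  using spectral_norm_transpose_le[of M] spectral_norm_transpose_le[of "transpose M"] by simp

text \<open>Each row of \<open>Z ** N\<close> is \<open>transpose N\<close> applied to a row of
  \<open>Z\<close>, so the spectral bound holds row by row. This mixed estimate is what lets the
  spectral norm of \<open>B\<close> govern the step size.\<close>

lemma norm_mult_le_right: "norm ((Z :: real^'b^'a) ** N) \<le> spectral_norm N * norm Z"
proof -
  have "(Z ** N) $ i = transpose N *v (Z $ i)" for i
    by (simp add: vec_eq_iff matrix_matrix_mult_def vector_matrix_mult_def mult_ac)
  then have "norm ((Z ** N) $ i) \<le> spectral_norm N * norm (Z $ i)" for i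
    by (metis spectral_norm_bound spectral_norm_transpose)
  then have "norm (Z ** N) \<le> L2_set (\<lambda>i. spectral_norm N * norm (Z $ i)) UNIV"
    unfolding norm_vec_def[of "Z ** N"] by (intro L2_set_mono) auto
  then show ?thesis
    by (simp add: norm_vec_def[of Z] L2_set_right_distrib)
qed

lemma norm_mult_le_left: "norm ((N :: real^'b^'a) ** Z) \<le> spectral_norm N * norm Z"
  using norm_mult_le_right[of "transpose Z" "transpose N"]
  unfolding matrix_transpose_mul[symmetric] by simp

lemma spectral_norm_le_norm: "spectral_norm (M :: real^'b^'a) \<le> norm M"
  unfolding spectral_norm_def
proof (rule onorm_le)
  fix v :: "real^'b"
  have "norm ((M *v v) $ i) \<le> norm (M $ i) * norm v" for i
    by (simp add: matrix_vector_mul_component Cauchy_Schwarz_ineq2)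
  then have "norm (M *v v) \<le> L2_set (\<lambda>i. norm (M $ i) * norm v) UNIV"
    unfolding norm_vec_def[of "M *v v"] by (intro L2_set_mono) auto
  then show "norm (M *v v) \<le> norm M * norm v"
    by (simp add: norm_vec_def[of M] L2_set_left_distrib)
qed

lemma norm_mult_le: "norm ((Y :: real^'b^'a) ** Z) \<le> norm Y * norm Z"
  by (rule order_trans[OF norm_mult_le_left mult_right_mono[OF spectral_norm_le_norm]]) simp

section \<open>The Moore--Penrose inverse\<close>

text \<open>Split \<open>b\<close> along the range of \<open>M\<close>: \<open>transpose M\<close>
  annihilates the orthogonal component, and the other component is some
  \<open>M *v x\<close>.\<close>

lemma least_squares_solution: "\<exists>x. transpose M *v (M *v x) = transpose M *v (b :: real^'a)"
  for M :: "real^'b^'a"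
proof -
  let ?S = "range ((*v) M)"
  have sp: "span ?S = ?S"
    by (simp add: linear_subspace_image span_eq_iff)
  obtain y z where yz: "y \<in> span ?S" "\<And>w. w \<in> span ?S \<Longrightarrow> orthogonal z w" "b = y + z"
    using orthogonal_subspace_decomp_exists[of ?S b] by metis
  then obtain x where x: "y = M *v x"
    using sp by auto
  have "(transpose M *v z) \<bullet> w = 0" for w
    using yz(2)[of "M *v w"] sp by (simp add: orthogonal_def dot_lmul_matrix)
  then have "transpose M *v z = 0"
    by (metis inner_eq_zero_iff)
  then show ?thesis
    using x yz(3) by (auto simp: matrix_vector_right_distrib simp del: transpose_matrix_vector)
qed

lemma normal_equation_solvable: "\<exists>G. transpose M ** M ** G = transpose (M :: real^'b^'a)"
proof -
  obtain g where g: "\<And>b. transpose M *v (M *v g b) = transpose M *v b"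
    using least_squares_solution[of M] by metis
  \<comment> \<open>The witness has as its column \<open>j\<close> a least-squares solution for the
    unit vector \<open>axis j 1\<close>.\<close>
  have "(transpose M ** M ** (\<chi> i j. g (axis j 1) $ i)) $ i $ j = transpose M $ i $ j" for i j
  proof -
    have "(transpose M ** M ** (\<chi> i j. g (axis j 1) $ i)) $ i $ j
        = ((transpose M ** M) *v g (axis j 1)) $ i"
      by (simp add: matrix_matrix_mult_def[of "transpose M ** M"] matrix_vector_mult_def)
    also have "\<dots> = (transpose M *v axis j 1) $ i"
      by (simp add: g del: transpose_matrix_vector flip: matrix_vector_mul_assoc)
    also have "\<dots> = transpose M $ i $ j"
      by (simp add: matrix_vector_mult_basis column_def del: transpose_matrix_vector)
    finally show ?thesis .
  qed
  then show ?thesis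
    by (metis vec_eq_iff)
qed

lemma least_squares_inverse_exists:
  "\<exists>G. M ** G ** M = M \<and> transpose (M ** G) = M ** G" for M :: "real^'b^'a"
proof -
  obtain G where G: "transpose M ** M ** G = transpose M"
    using normal_equation_solvable by blast
  have "transpose (M ** G) = transpose G ** (transpose M ** M ** G)"
    by (simp add: G matrix_transpose_mul)
  also have "\<dots> = transpose (M ** G) ** (M ** G)"
    by (simp add: matrix_transpose_mul matrix_mul_assoc)
  finally have sym: "transpose (M ** G) = transpose (M ** G) ** (M ** G)" .
  \<comment> \<open>The right-hand side of \<open>sym\<close> is symmetric, so transposing
    \<open>sym\<close> identifies \<open>M ** G\<close> with its transpose.\<close>
  have sym': "transpose (M ** G) = M ** G"
    by (metis sym matrix_transpose_mul transpose_transpose)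
  have "transpose M ** M ** (G ** M - mat 1) = 0"
    by (simp add: matrix_mult_diff_right matrix_mul_assoc G)
  then have "M ** (G ** M - mat 1) = 0"
    by (rule gram_mult_eq_0)
  then show ?thesis
    using sym' by (auto simp: matrix_mult_diff_right matrix_mul_assoc)
qed

text \<open>
  If \<open>G\<close> and \<open>K\<close> satisfy the first Penrose condition and \<open>M ** G\<close>, \<open>K ** M\<close> are symmetric, then
  \<open>K ** M ** G\<close> satisfies all four. Such a \<open>K\<close> is the transpose of a \<open>G\<close> for \<open>transpose M\<close>.
\<close>

lemma mp_inverse_exists: "\<exists>P. is_mp_inverse (M :: real^'b^'a) P"
proof -
  obtain G where G: "M ** G ** M = M" "transpose (M ** G) = M ** G"
    using least_squares_inverse_exists[of M] by blast
  obtain H where "transpose M ** H ** transpose M = transpose M"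
      "transpose (transpose M ** H) = transpose M ** H"
    using least_squares_inverse_exists[of "transpose M"] by blast
  then have K: "M ** transpose H ** M = M" "transpose (transpose H ** M) = transpose H ** M"
    by (metis matrix_transpose_mul transpose_transpose matrix_mul_assoc)+
  let ?P = "transpose H ** M ** G"
  have MP: "M ** ?P = M ** G"
    by (simp add: K matrix_mul_assoc)
  have PM: "?P ** M = transpose H ** M"
    using G(1) by (simp flip: matrix_mul_assoc)
  have "?P ** M ** ?P = ?P"
    unfolding PM using K(1) by (simp add: matrix_mul_assoc) (metis matrix_mul_assoc)
  then have "is_mp_inverse M ?P"
    unfolding is_mp_inverse_def MP PM using G K by (simp add: MP)
  then show ?thesis ..
qed

text \<open>Both \<open>M ** P\<close> and \<open>M ** Q\<close> are symmetric and each fixes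
  \<open>M\<close> from the left; comparing their product with its transpose shows them equal.
  Likewise \<open>P ** M = Q ** M\<close>, and \<open>P = P ** M ** P\<close> is determined by these
  products.\<close>

lemma mp_inverse_unique:
  assumes "is_mp_inverse (M :: real^'b^'a) P" "is_mp_inverse M Q"
  shows "P = Q"
proof -
  note P = assms(1)[unfolded is_mp_inverse_def] and Q = assms(2)[unfolded is_mp_inverse_def]
  have "M ** P = transpose (M ** P) ** transpose (M ** Q)"
  proof -
    have "transpose (M ** P) ** transpose (M ** Q) = transpose (M ** Q ** M ** P)"
      by (simp add: matrix_transpose_mul matrix_mul_assoc)
    then show ?thesis using P Q by simp
  qed
  then have MP: "M ** P = M ** Q"
    using P Q by (simp add: matrix_mul_assoc)
  have "P ** M = transpose (P ** M) ** transpose (Q ** M)"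
    using P Q by (metis matrix_mul_assoc)
  also have "\<dots> = transpose (Q ** (M ** P ** M))"
    by (simp add: matrix_transpose_mul matrix_mul_assoc)
  finally have PM: "P ** M = Q ** M"
    using P Q by simp
  have "P = P ** M ** P" "Q = Q ** M ** Q"
    using P Q by simp_all
  then show ?thesis
    using MP PM by (metis matrix_mul_assoc)
qed

lemma is_mp_inverse_mp_inverse: "is_mp_inverse M (mp_inverse (M :: real^'b^'a))"
  unfolding mp_inverse_def
  using mp_inverse_exists mp_inverse_unique by (metis theI)

lemma
  fixes M :: "real^'b^'a"
  shows mp_inverse_outer: "M ** mp_inverse M ** M = M"
    and mp_inverse_inner: "mp_inverse M ** M ** mp_inverse M = mp_inverse M"
    and mp_inverse_sym_left: "transpose (M ** mp_inverse M) = M ** mp_inverse M"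
    and mp_inverse_sym_right: "transpose (mp_inverse M ** M) = mp_inverse M ** M"
  using is_mp_inverse_mp_inverse[of M] unfolding is_mp_inverse_def by auto

lemma mp_inverse_mult_transpose:
  "mp_inverse M ** M ** transpose M = transpose (M :: real^'b^'a)"
  by (metis matrix_mul_assoc matrix_transpose_mul mp_inverse_outer mp_inverse_sym_right)

lemma transpose_mult_mp_inverse:
  "transpose M ** (M ** mp_inverse M) = transpose (M :: real^'b^'a)"
  by (metis matrix_mul_assoc matrix_transpose_mul mp_inverse_outer mp_inverse_sym_left)

text \<open>Exhibits a factor \<open>transpose M\<close> on the left; with the mirrored lemma below
  it puts A^+ C B^+ into the form A^T W B^T.\<close>

lemma mp_inverse_factor_left:
  "mp_inverse M = transpose M ** (transpose (mp_inverse M) ** mp_inverse (M :: real^'b^'a))"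
  by (metis matrix_mul_assoc matrix_transpose_mul mp_inverse_inner mp_inverse_sym_right)

lemma mp_inverse_factor_right:
  "mp_inverse M = (mp_inverse M ** transpose (mp_inverse M)) ** transpose (M :: real^'b^'a)"
  by (metis matrix_mul_assoc matrix_transpose_mul mp_inverse_inner mp_inverse_sym_left)

lemma mp_inverse_nonzero: "(M :: real^'b^'a) \<noteq> 0 \<Longrightarrow> mp_inverse M \<noteq> 0"
  using mp_inverse_outer[of M] by auto

section \<open>Kronecker products and vectorization\<close>

lemma sum_UNIV_pair: "(\<Sum>r\<in>UNIV. f (r :: 'a::finite \<times> 'b::finite)) = (\<Sum>i\<in>UNIV. \<Sum>j\<in>UNIV. f (i, j))"
  by (simp add: UNIV_Times_UNIV[symmetric] sum.cartesian_product del: UNIV_Times_UNIV)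

lemma norm_vec_cols [simp]: "norm (vec_cols (Y :: real^'q^'p)) = norm Y"
proof -
  have "(norm (vec_cols Y))\<^sup>2 = (norm (transpose Y))\<^sup>2"
    unfolding power2_norm_eq_inner inner_matrix
    by (simp add: inner_vec_def vec_cols_def transpose_def sum_UNIV_pair)
  then show ?thesis by simp
qed

lemma vec_cols_surj: "\<exists>Y :: real^'q^'p. v = vec_cols Y"
  by (rule exI[of _ "\<chi> i j. v $ (j, i)"]) (simp add: vec_cols_def vec_eq_iff)

lemma vec_cols_inject: "vec_cols Y = vec_cols Z \<Longrightarrow> Y = (Z :: real^'q^'p)"
  by (simp add: vec_cols_def vec_eq_iff)

lemma transpose_kronecker:
  "transpose (kronecker M N) = kronecker (transpose M) (transpose N)"
  by (simp add: transpose_def kronecker_def)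

lemma norm_kronecker: "norm (kronecker (M :: real^'b^'a) (N :: real^'d^'c)) = norm M * norm N"
proof -
  have "(norm (kronecker M N))\<^sup>2 = (norm M * norm N)\<^sup>2"
    unfolding power_mult_distrib power2_norm_eq_inner inner_matrix sum_product
    by (simp add: kronecker_def sum_UNIV_pair mult_ac)
  then show ?thesis by simp
qed

text \<open>On the range of \<open>transpose M\<close> the projection
  \<open>mp_inverse M ** M\<close> is the identity, so \<open>v\<close> is recovered from
  \<open>M *v v\<close>.\<close>

lemma norm_le_mp_inverse:
  fixes M :: "real^'b^'a"
  assumes "v \<in> matrix_range (transpose M)"
  shows "norm v \<le> spectral_norm (mp_inverse M) * norm (M *v v)"
proof -
  obtain w where w: "v = transpose M *v w"
    using assms by (auto simp: matrix_range_def)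
  have "mp_inverse M *v (M *v v) = v"
    unfolding w by (simp add: matrix_vector_mul_assoc matrix_mul_assoc mp_inverse_mult_transpose del: transpose_matrix_vector)
  then show ?thesis
    by (metis spectral_norm_bound)
qed

section \<open>One step of the iteration\<close>

lemma norm_rowvector [simp]: "norm (rowvector v :: real^'n^1) = norm v"
proof -
  have "(rowvector v :: real^'n^1) $ 1 = v"
    by (simp add: rowvector_def)
  then show ?thesis by (metis norm_vector_1)
qed

lemma rowvector_row_mult:
  "(rowvector (row i (Y ** Z)) :: real^'n^1) = rowvector (row i (Y :: real^'p^'m)) ** Z"
  by (simp add: rowvector_def row_def matrix_matrix_mult_def vec_eq_iff)

lemma rowvector_row_diff:
  "(rowvector (row i (Y - Z :: real^'n^'m)) :: real^'n^1) = rowvector (row i Y) - rowvector (row i Z)"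
  by (simp add: rowvector_def row_def vec_eq_iff)

lemma mwrbk_step_residual:
  "mwrbk_step A B C \<alpha> i X = X + (\<alpha> / (norm (row i A))\<^sup>2) *\<^sub>R
     (transpose (rowvector (row i A) :: real^'p^1)
       ** (rowvector (row i (residual A B C X)) :: real^'n^1) ** transpose B)"
  for A :: "real^'p^'m" and B :: "real^'n^'q"
  by (simp add: mwrbk_step_def residual_def rowvector_row_diff rowvector_row_mult)

lemma residual_solution:
  "A ** Y ** B = C \<Longrightarrow> residual A B C X = A ** (Y - X) ** B"
  by (simp add: residual_def matrix_mult_diff_left matrix_mult_diff_right)

text \<open>The update is a multiple of \<open>D\<close>. Its inner product with the error is known
  exactly, while its norm is only bounded, through the spectral norm of \<open>B\<close>; this gives
  the linear and quadratic terms in \<alpha>.\<close>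

lemma mwrbk_step_error:
  fixes A :: "real^'p^'m" and B :: "real^'n^'q" and C :: "real^'n^'m"
  assumes sol: "A ** Y ** B = C" and nz: "row i A \<noteq> 0"
  shows "(norm (mwrbk_step A B C \<alpha> i X - Y))\<^sup>2 \<le> (norm (X - Y))\<^sup>2 -
     (2 * \<alpha> - \<alpha>\<^sup>2 * (spectral_norm B)\<^sup>2) *
       ((norm (row i (residual A B C X)))\<^sup>2 / (norm (row i A))\<^sup>2)"
proof -
  let ?s = "spectral_norm B"
  define a :: "real^'p^1" where "a = rowvector (row i A)"
  define U :: "real^'n^1" where "U = rowvector (row i (residual A B C X))"
  define F where "F = Y - X"
  define D where "D = transpose a ** U ** transpose B"
  define n where "n = norm (row i A)"
  define u where "u = norm U"
  have n: "n > 0" using nz by (simp add: n_def)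
  have na: "norm (transpose a) = n" by (simp add: a_def n_def)
  have U: "U = a ** F ** B"
    by (simp add: U_def residual_solution[OF sol] rowvector_row_mult a_def F_def)
  \<comment> \<open>Moving the outer factors of \<open>D\<close> onto \<open>F\<close> produces
    \<open>a ** F ** B\<close>, which is \<open>U\<close> itself.\<close>
  have FD: "F \<bullet> D = u\<^sup>2"
    unfolding D_def inner_matrix_mult_both[symmetric] by (simp add: u_def power2_norm_eq_inner flip: U)
  have "norm D \<le> n * (?s * u)"
  proof -
    have "norm D \<le> norm (transpose a) * norm (U ** transpose B)"
      unfolding D_def matrix_mul_assoc[symmetric] by (rule norm_mult_le)
    also have "\<dots> \<le> n * (?s * u)"
      using norm_mult_le_right[of U "transpose B"] n unfolding na u_def
      by (intro mult_left_mono) auto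
    finally show ?thesis .
  qed
  then have D: "(norm D)\<^sup>2 \<le> n\<^sup>2 * (?s\<^sup>2 * u\<^sup>2)"
    by (metis norm_ge_zero power_mono power_mult_distrib)
  have expand: "(norm (t *\<^sub>R D - F))\<^sup>2 = (norm F)\<^sup>2 - 2 * t * u\<^sup>2 + t\<^sup>2 * (norm D)\<^sup>2" for t
    by (simp add: power2_norm_eq_inner inner_diff_left inner_diff_right inner_commute[of D F] FD)
      (simp add: power2_eq_square algebra_simps)
  have "mwrbk_step A B C \<alpha> i X - Y = (\<alpha> / n\<^sup>2) *\<^sub>R D - F"
    by (simp add: mwrbk_step_residual D_def a_def U_def F_def n_def)
  then have "(norm (mwrbk_step A B C \<alpha> i X - Y))\<^sup>2
      = (norm F)\<^sup>2 - 2 * (\<alpha> / n\<^sup>2) * u\<^sup>2 + (\<alpha> / n\<^sup>2)\<^sup>2 * (norm D)\<^sup>2"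
    by (simp only: expand)
  also have "\<dots> \<le> (norm F)\<^sup>2 - 2 * (\<alpha> / n\<^sup>2) * u\<^sup>2 + (\<alpha> / n\<^sup>2)\<^sup>2 * (n\<^sup>2 * (?s\<^sup>2 * u\<^sup>2))"
    using D by (intro add_left_mono mult_left_mono) auto
  also have "\<dots> = (norm F)\<^sup>2 - (2 * \<alpha> - \<alpha>\<^sup>2 * ?s\<^sup>2) * (u\<^sup>2 / n\<^sup>2)"
    using n by (simp add: field_simps power2_eq_square)
  finally show ?thesis
    by (simp add: F_def n_def u_def U_def norm_minus_commute)
qed

text \<open>As a sum over the nonzero rows, the coefficient is visibly nonnegative and ready for the
  mediant argument.\<close>

lemma gamma_coeff_eq:
  "gamma_coeff (A :: real^'p^'m) (R :: real^'n^'m) = (\<Sum>i\<in>- zero_rows R. (norm (row i A))\<^sup>2)"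
  unfolding gamma_coeff_def norm_matrix_sq
  by (simp add: sum.subset_diff[of "zero_rows R" UNIV] Compl_eq_Diff_UNIV)

lemma gamma_coeff_bounds:
  fixes A :: "real^'p^'m" and R :: "real^'n^'m"
  shows "0 \<le> gamma_coeff A R" "gamma_coeff A R \<le> (norm A)\<^sup>2"
  by (simp_all add: gamma_coeff_eq sum_nonneg) (simp add: gamma_coeff_def sum_nonneg flip: gamma_coeff_eq)

text \<open>The maximal row ratio dominates the mediant of the ratios over the nonzero rows.\<close>

lemma greedy_ratio:
  fixes A :: "real^'p^'m" and R :: "real^'n^'m"
  assumes rows: "\<And>i. row i A \<noteq> 0" and i: "i \<in> greedy_set A R"
  shows "(norm R)\<^sup>2 \<le> gamma_coeff A R * ((norm (row i R))\<^sup>2 / (norm (row i A))\<^sup>2)"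
proof -
  let ?q = "\<lambda>j. (norm (row j R))\<^sup>2 / (norm (row j A))\<^sup>2"
  have "?q j \<le> ?q i" for j
    using i by (simp add: greedy_set_def)
  then have le: "(norm (row j R))\<^sup>2 \<le> (norm (row j A))\<^sup>2 * ?q i" for j
    using rows[of j] by (metis mult.commute norm_eq_zero pos_divide_le_eq zero_less_power2)
  \<comment> \<open>Discarding the zero rows here is what yields \<open>gamma_coeff\<close> instead
    of the full squared norm of \<open>A\<close>.\<close>
  have "(norm R)\<^sup>2 = (\<Sum>j\<in>- zero_rows R. (norm (row j R))\<^sup>2)"
    unfolding norm_matrix_sq by (rule sum.mono_neutral_right) (auto simp: zero_rows_def)
  also have "\<dots> \<le> (\<Sum>j\<in>- zero_rows R. (norm (row j A))\<^sup>2 * ?q i)"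
    by (intro sum_mono le)
  also have "\<dots> = gamma_coeff A R * ?q i"
    by (simp only: gamma_coeff_eq sum_distrib_right)
  finally show ?thesis .
qed

text \<open>The upper bound \<open>g\<close> and the lower-bound constant \<open>r\<close> stay
  free, so that one estimate serves the initial factor, the later factors and the uniform rate for
  convergence.\<close>

lemma greedy_step_error:
  fixes A :: "real^'p^'m" and B :: "real^'n^'q" and C :: "real^'n^'m"
  assumes sol: "A ** Y ** B = C" and rows: "\<And>i. row i A \<noteq> 0"
    and i: "i \<in> greedy_set A (residual A B C X)"
    and c: "0 \<le> 2 * \<alpha> - \<alpha>\<^sup>2 * (spectral_norm B)\<^sup>2"
    and g: "gamma_coeff A (residual A B C X) \<le> g"
    and r: "r * (norm (X - Y))\<^sup>2 \<le> (norm (residual A B C X))\<^sup>2"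
  shows "(norm (mwrbk_step A B C \<alpha> i X - Y))\<^sup>2
    \<le> (1 - (2 * \<alpha> - \<alpha>\<^sup>2 * (spectral_norm B)\<^sup>2) / g * r) * (norm (X - Y))\<^sup>2"
proof -
  let ?c = "2 * \<alpha> - \<alpha>\<^sup>2 * (spectral_norm B)\<^sup>2" and ?R = "residual A B C X"
  let ?q = "(norm (row i ?R))\<^sup>2 / (norm (row i A))\<^sup>2"
  have g0: "0 \<le> g" using gamma_coeff_bounds(1)[of A ?R] g by linarith
  have "r * (norm (X - Y))\<^sup>2 \<le> g * ?q"
    using greedy_ratio[OF rows i] r mult_right_mono[OF g, of ?q] by (simp del: times_divide_eq_right)
  then have "?c / g * (r * (norm (X - Y))\<^sup>2) \<le> ?c / g * (g * ?q)"
    using c g0 by (intro mult_left_mono divide_nonneg_nonneg)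
  also have "\<dots> \<le> ?c * ?q"
    \<comment> \<open>Otherwise \<open>g\<close> cancels; for \<open>g = 0\<close> the left side is
      0 and the right side is nonnegative.\<close>
    using c by (cases "g = 0") simp_all
  finally show ?thesis
    using mwrbk_step_error[OF sol rows, of \<alpha> i X] by (simp add: algebra_simps)
qed

section \<open>Errors in the range of the adjoint\<close>

text \<open>Translates the hypothesis on the initial matrix: the triple-product identity applies
  with \<open>transpose A\<close> and \<open>transpose B\<close>, and every vector is some
  \<open>vec_cols W\<close>.\<close>

lemma vec_cols_in_range_iff:
  fixes A :: "real^'p^'m" and B :: "real^'n^'q"
  shows "vec_cols E \<in> matrix_range (kronecker B (transpose A))
    \<longleftrightarrow> (\<exists>W. E = transpose A ** W ** transpose B)"
proof
  assume "vec_cols E \<in> matrix_range (kronecker B (transpose A))"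
  then obtain v where "vec_cols E = kronecker B (transpose A) *v v"
    by (auto simp: matrix_range_def)
  moreover obtain W where "v = vec_cols W"
    using vec_cols_surj by blast
  ultimately have "vec_cols E = vec_cols (transpose A ** W ** transpose B)"
    by (simp add: vec_cols_triple_product)
  then show "\<exists>W. E = transpose A ** W ** transpose B"
    using vec_cols_inject by blast
next
  assume "\<exists>W. E = transpose A ** W ** transpose B"
  then show "vec_cols E \<in> matrix_range (kronecker B (transpose A))"
    by (auto simp: matrix_range_def vec_cols_triple_product)
qed

text \<open>The assumption places \<open>vec_cols E\<close> in the range of the transposed Kronecker
  matrix, where its pseudoinverse inverts it. This supplies the constant of the initial
  step.\<close>

lemma norm_le_kronecker:
  fixes A :: "real^'p^'m" and B :: "real^'n^'q"
  assumes "E = transpose A ** W ** transpose B"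
  shows "norm E \<le> spectral_norm (mp_inverse (kronecker (transpose B) A)) * norm (A ** E ** B)"
proof -
  have "vec_cols E \<in> matrix_range (transpose (kronecker (transpose B) A))"
    using assms vec_cols_in_range_iff[of E B A] by (auto simp: transpose_kronecker)
  from norm_le_mp_inverse[OF this] show ?thesis
    by (simp flip: vec_cols_triple_product)
qed

lemma norm_le_mp_inverses:
  fixes A :: "real^'p^'m" and B :: "real^'n^'q"
  assumes "E = transpose A ** W ** transpose B"
  shows "norm E \<le> spectral_norm (mp_inverse A) * spectral_norm (mp_inverse B) * norm (A ** E ** B)"
proof -
  have "E = mp_inverse A ** A ** transpose A ** W ** (transpose B ** (B ** mp_inverse B))"
    unfolding assms mp_inverse_mult_transpose transpose_mult_mp_inverse ..
  also have "\<dots> = mp_inverse A ** (A ** E ** B) ** mp_inverse B"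
    by (simp add: assms matrix_mul_assoc)
  finally have "norm E \<le> spectral_norm (mp_inverse B) * norm (mp_inverse A ** (A ** E ** B))"
    by (metis norm_mult_le_right)
  also have "\<dots> \<le> spectral_norm (mp_inverse B) * (spectral_norm (mp_inverse A) * norm (A ** E ** B))"
    by (intro mult_left_mono norm_mult_le_left) simp
  finally show ?thesis
    by (simp add: mult_ac)
qed

text \<open>Since \<open>1 / 0 = 0\<close>, the bound also covers \<open>s = 0\<close>, so no
  positivity of a pseudoinverse norm has to be shown first.\<close>

lemma inverse_square_bound:
  fixes s :: real
  assumes "0 \<le> x" "x \<le> s * y"
  shows "(1 / s)\<^sup>2 * x\<^sup>2 \<le> y\<^sup>2"
proof (cases "s = 0")
  case False
  have "x\<^sup>2 \<le> s\<^sup>2 * y\<^sup>2"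
    using power_mono[OF assms(2,1), of 2] by (simp add: power_mult_distrib)
  then show ?thesis
    using False by (simp add: field_simps)
qed simp

section \<open>The least-norm solution and the range of the iterates\<close>

text \<open>\<open>Z\<close> is orthogonal to every difference of solutions, so Pythagoras gives
  minimality and uniqueness together.\<close>

lemma least_norm_solution_characterization:
  fixes A :: "real^'p^'m" and B :: "real^'n^'q" and C :: "real^'n^'m"
  assumes sol: "A ** Z ** B = C" and Z: "Z = transpose A ** W ** transpose B"
  shows "is_least_norm_solution A B C Y \<longleftrightarrow> Y = Z"
proof -
  have pyth: "(norm Y)\<^sup>2 = (norm Z)\<^sup>2 + (norm (Y - Z))\<^sup>2" if "A ** Y ** B = C" for Y
  proof -
    have "(Y - Z) \<bullet> Z = (A ** (Y - Z) ** B) \<bullet> W"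
      unfolding inner_matrix_mult_both Z[symmetric] ..
    also have "\<dots> = 0"
      using sol that by (simp add: matrix_mult_diff_left matrix_mult_diff_right)
    finally show ?thesis
      by (simp add: power2_norm_eq_inner algebra_simps inner_commute)
  qed
  show ?thesis
  proof
    assume Y: "is_least_norm_solution A B C Y"
    then have "norm Y \<le> norm Z" and "A ** Y ** B = C"
      using sol by (auto simp: is_least_norm_solution_def)
    then have "(norm (Y - Z))\<^sup>2 \<le> 0"
      using pyth[of Y] power_mono[of "norm Y" "norm Z" 2] by simp
    then show "Y = Z" by simp
  next
    assume "Y = Z"
    moreover have "norm Z \<le> norm Y" if "A ** Y ** B = C" for Y
      by (rule power2_le_imp_le) (simp_all add: pyth[OF that])
    ultimately show "is_least_norm_solution A B C Y"
      using sol unfolding is_least_norm_solution_def by blast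
  qed
qed

text \<open>Consistency lets \<open>C\<close> be replaced by \<open>A ** Y ** B\<close>, after which
  the first Penrose condition applies on both sides.\<close>

lemma mp_solution:
  assumes "\<exists>Y :: real^'q^'p. A ** Y ** B = C"
  shows "A ** (mp_inverse A ** C ** mp_inverse B) ** B = (C :: real^'n^'m)"
proof -
  obtain Y where Y: "C = A ** Y ** B"
    using assms by blast
  have "A ** (mp_inverse A ** C ** mp_inverse B) ** B
      = (A ** mp_inverse A ** A) ** Y ** (B ** mp_inverse B ** B)"
    by (simp add: Y matrix_mul_assoc)
  then show ?thesis
    by (simp only: mp_inverse_outer Y)
qed

lemma mp_solution_in_range:
  fixes A :: "real^'p^'m" and B :: "real^'n^'q"
  shows "\<exists>W. mp_inverse A ** C ** mp_inverse B = transpose A ** W ** transpose B"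
proof -
  have "mp_inverse A ** C ** mp_inverse B
      = transpose A ** (transpose (mp_inverse A) ** mp_inverse A ** C
          ** mp_inverse B ** transpose (mp_inverse B)) ** transpose B"
    by (subst mp_inverse_factor_left, subst mp_inverse_factor_right) (simp add: matrix_mul_assoc)
  then show ?thesis by blast
qed

text \<open>The transposed row of \<open>A\<close> is \<open>transpose A\<close> applied to a unit
  vector, and the increment already ends in \<open>transpose B\<close>.\<close>

lemma mwrbk_step_in_range:
  fixes A :: "real^'p^'m" and B :: "real^'n^'q"
  shows "\<exists>W. mwrbk_step A B C \<alpha> i X - X = transpose A ** W ** transpose B"
proof -
  have "transpose (rowvector (row i A) :: real^'p^1) = columnvector (transpose A *v axis i 1)"
    by (simp only: transpose_rowvector matrix_vector_mult_basis column_transpose)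
  then have "transpose (rowvector (row i A) :: real^'p^1) = transpose A ** columnvector (axis i 1)"
    by (simp only: dot_rowvector_columnvector)
  then have "mwrbk_step A B C \<alpha> i X - X = transpose A ** ((\<alpha> / (norm (row i A))\<^sup>2) *\<^sub>R
      (columnvector (axis i 1) ** (rowvector (row i (residual A B C X)) :: real^'n^1))) ** transpose B"
    by (simp add: mwrbk_step_residual matrix_mul_assoc matrix_scalar_ac scalar_matrix_assoc)
  then show ?thesis by blast
qed

lemma diff_in_range:
  fixes A :: "real^'p^'m" and B :: "real^'n^'q"
  assumes "\<exists>W. Y = transpose A ** W ** transpose B" "\<exists>W. Z = transpose A ** W ** transpose B"
  shows "\<exists>W. Y - Z = transpose A ** W ** transpose B"
  using assms by (metis matrix_mult_diff_left matrix_mult_diff_right)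

lemma me_mwrbk_sequence_in_range:
  fixes A :: "real^'p^'m" and B :: "real^'n^'q"
  assumes gen: "me_mwrbk_sequence A B C \<alpha> X"
    and X0: "\<exists>W. X 0 = transpose A ** W ** transpose B"
  shows "\<exists>W. X k = transpose A ** W ** transpose B"
proof (induction k)
  case (Suc k)
  \<comment> \<open>The sign is chosen so that \<open>X (Suc k)\<close> is \<open>X k\<close> minus
    this matrix and closure under differences suffices.\<close>
  have "\<exists>W. X k - X (Suc k) = transpose A ** W ** transpose B"
  proof (cases "residual A B C (X k) = 0")
    case True
    then have "X (Suc k) = X k"
      using gen by (simp add: me_mwrbk_sequence_def)
    then show ?thesis by (intro exI[of _ 0]) simp
  next
    case False
    then obtain i where i: "X (Suc k) = mwrbk_step A B C \<alpha> i (X k)"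
      using gen unfolding me_mwrbk_sequence_def by metis
    have "\<exists>W. X k - X k = transpose A ** W ** transpose B"
      by (intro exI[of _ 0]) simp
    from diff_in_range[OF this mwrbk_step_in_range[of A B C \<alpha> i "X k"]] show ?thesis
      by (simp add: i)
  qed
  from diff_in_range[OF Suc this] show ?case by simp
qed (rule X0)

section \<open>Convergence and the error bound\<close>

theorem theorem4p8:
  fixes A :: "real^'p^'m" and B :: "real^'n^'q" and C :: "real^'n^'m"
    and \<alpha> :: real and X :: "nat \<Rightarrow> real^'q^'p"
  assumes rows_nonzero: "\<And>i. row i A \<noteq> 0"
    and B_nonzero: "B \<noteq> 0"
    and consistent: "\<exists>Y :: real^'q^'p. A ** Y ** B = C"
    and alpha_pos: "0 < \<alpha>"
    and alpha_less: "\<alpha> < 2 / (spectral_norm B)\<^sup>2"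
    and generated: "me_mwrbk_sequence A B C \<alpha> X"
    and initial: "vec_cols (X 0) \<in> matrix_range (kronecker B (transpose A))"
  shows "is_least_norm_solution A B C (mp_inverse A ** C ** mp_inverse B)
    \<and> (\<forall>Y. is_least_norm_solution A B C Y \<longrightarrow> Y = mp_inverse A ** C ** mp_inverse B)
    \<and> X \<longlonglongrightarrow> mp_inverse A ** C ** mp_inverse B
    \<and> (\<forall>k. (\<forall>l\<in>{1..k}. residual A B C (X l) \<noteq> 0) \<longrightarrow>
          (frob_norm (X (Suc k) - mp_inverse A ** C ** mp_inverse B))\<^sup>2
            \<le> (\<Prod>l=0..k. rho_coeff A B C \<alpha> X l)
                * (frob_norm (X 0 - mp_inverse A ** C ** mp_inverse B))\<^sup>2)"
proof -
  define Z where "Z = mp_inverse A ** C ** mp_inverse B"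
  define c where "c = 2 * \<alpha> - \<alpha>\<^sup>2 * (spectral_norm B)\<^sup>2"
  define R where "R k = residual A B C (X k)" for k
  define e where "e k = (norm (X k - Z))\<^sup>2" for k
  let ?sA = "spectral_norm (mp_inverse A)" and ?sB = "spectral_norm (mp_inverse B)"
  let ?K = "kronecker (transpose B) A"
  have sol: "A ** Z ** B = C"
    unfolding Z_def by (rule mp_solution[OF consistent])
  have Z: "\<exists>W. Z = transpose A ** W ** transpose B"
    unfolding Z_def by (rule mp_solution_in_range)
  have "A \<noteq> 0"
    using rows_nonzero by (force simp: row_def vec_eq_iff)
  have "(spectral_norm B)\<^sup>2 > 0"
    using spectral_norm_pos[OF B_nonzero] by simp
  then have "\<alpha> * (spectral_norm B)\<^sup>2 < 2"
    using alpha_less by (simp add: field_simps)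
  then have c: "0 < c"
    using alpha_pos by (simp add: c_def power2_eq_square mult.assoc)
  have err: "\<exists>W. X k - Z = transpose A ** W ** transpose B" for k
    by (rule diff_in_range[OF me_mwrbk_sequence_in_range[OF generated
          initial[unfolded vec_cols_in_range_iff]] Z])
  have "A ** (X k - Z) ** B = - R k" for k
    by (simp add: R_def residual_def matrix_mult_diff_left matrix_mult_diff_right sol)
  then have R: "norm (A ** (X k - Z) ** B) = norm (R k)" for k
    by simp
  have bound_K: "(1 / spectral_norm (mp_inverse ?K))\<^sup>2 * e k \<le> (norm (R k))\<^sup>2" for k
  proof -
    obtain W' where "X k - Z = transpose A ** W' ** transpose B"
      using err by blast
    from norm_le_kronecker[OF this] show ?thesis
      unfolding e_def R by (intro inverse_square_bound) auto
  qed
  have err_le: "norm (X k - Z) \<le> ?sA * ?sB * norm (R k)" for k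
  proof -
    obtain W' where "X k - Z = transpose A ** W' ** transpose B"
      using err by blast
    from norm_le_mp_inverses[OF this] show ?thesis
      unfolding R .
  qed
  have bound_AB: "((sigma_min A)\<^sup>2 * (sigma_min B)\<^sup>2) * e k \<le> (norm (R k))\<^sup>2" for k
    using inverse_square_bound[OF norm_ge_zero err_le[of k]]
    by (simp add: e_def sigma_min_def power_divide power_mult_distrib)
  \<comment> \<open>Because the error lies in the adjoint range, a run that stops has stopped
    exactly at \<open>Z\<close>.\<close>
  have zero: "R k = 0 \<longleftrightarrow> e k = 0" for k
  proof
    assume "R k = 0"
    with err_le[of k] show "e k = 0" by (simp add: e_def)
  next
    assume "e k = 0"
    then have "X k = Z" by (simp add: e_def)
    then show "R k = 0" by (simp add: R_def residual_def sol)
  qed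
  have step: "e (Suc k) \<le> (1 - c / g * r) * e k"
    if nz: "R k \<noteq> 0" and g: "gamma_coeff A (R k) \<le> g"
      and r: "r * e k \<le> (norm (R k))\<^sup>2" for k g r
  proof -
    obtain i where i: "i \<in> greedy_set A (R k)" "X (Suc k) = mwrbk_step A B C \<alpha> i (X k)"
      using nz generated[unfolded me_mwrbk_sequence_def, rule_format, of k]
      by (auto simp: R_def)
    show ?thesis
      using greedy_step_error[OF sol rows_nonzero, of i "X k" \<alpha> g r] i g r c
      by (simp add: e_def R_def c_def)
  qed
  have stop: "e (Suc k) = 0" if "R k = 0" for k
    using that generated[unfolded me_mwrbk_sequence_def, rule_format, of k] zero[of k]
    by (simp add: R_def e_def)

  have conv: "X \<longlonglongrightarrow> Z"
  proof -
    \<comment> \<open>Using the full norm of \<open>A\<close> in place of the varying coefficient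
      makes the rate independent of \<open>k\<close>; the maximum with 0 keeps it nonnegative for
      the induction on powers.\<close>
    define q where "q = max 0 (1 - c / (norm A)\<^sup>2 * ((sigma_min A)\<^sup>2 * (sigma_min B)\<^sup>2))"
    have "0 < sigma_min A" "0 < sigma_min B"
      using spectral_norm_pos mp_inverse_nonzero \<open>A \<noteq> 0\<close> B_nonzero
      by (auto simp: sigma_min_def)
    then have q: "0 \<le> q" "q < 1"
      using c \<open>A \<noteq> 0\<close> by (auto simp: q_def)
    have "e (Suc k) \<le> q * e k" for k
    proof (cases "R k = 0")
      case True
      then show ?thesis using stop zero by simp
    next
      case False
      have "e (Suc k) \<le> (1 - c / (norm A)\<^sup>2 * ((sigma_min A)\<^sup>2 * (sigma_min B)\<^sup>2)) * e k"
        by (rule step[OF False gamma_coeff_bounds(2) bound_AB])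
      also have "\<dots> \<le> q * e k"
        by (intro mult_right_mono) (auto simp: q_def e_def)
      finally show ?thesis .
    qed
    then have "e k \<le> q ^ k * e 0" for k
    proof (induction k)
      case (Suc k)
      have "e (Suc k) \<le> q * e k"
        by (rule Suc.prems)
      also have "\<dots> \<le> q * (q ^ k * e 0)"
        using Suc q by (intro mult_left_mono) auto
      finally show ?case by simp
    qed simp
    moreover have "(\<lambda>k. q ^ k * e 0) \<longlonglongrightarrow> 0"
      using q by (intro tendsto_mult_left_zero LIMSEQ_realpow_zero) auto
    ultimately have "e \<longlonglongrightarrow> 0"
      by (intro tendsto_sandwich[of "\<lambda>_. 0" e sequentially "\<lambda>k. q ^ k * e 0"])
        (auto simp: e_def)
    then have "(\<lambda>k. sqrt (e k)) \<longlonglongrightarrow> sqrt 0"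
      by (rule tendsto_real_sqrt)
    then have "(\<lambda>k. norm (X k - Z)) \<longlonglongrightarrow> 0"
      by (simp add: e_def)
    then show ?thesis
      by (simp add: LIM_zero_cancel tendsto_norm_zero_iff)
  qed

  have rho: "e (Suc k) \<le> rho_coeff A B C \<alpha> X k * e k" if "R k \<noteq> 0" for k
  proof (cases "k = 0")
    case True
    \<comment> \<open>The Frobenius norm of \<open>?K\<close> is the product of those of
      \<open>B\<close> and \<open>A\<close>, so the factor from \<open>B\<close> cancels.\<close>
    have "rho_coeff A B C \<alpha> X 0 = 1 - c / (norm A)\<^sup>2 * (1 / spectral_norm (mp_inverse ?K))\<^sup>2"
      using B_nonzero
      by (simp add: rho_coeff_def c_def kappa_F2_def norm_kronecker power_mult_distrib power_divide)
    then show ?thesis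
      using step[OF that gamma_coeff_bounds(2) bound_K] True by simp
  next
    case False
    then show ?thesis
      using step[OF that order_refl bound_AB]
      by (simp add: rho_coeff_def c_def R_def mult.assoc)
  qed
  have rate: "e (Suc k) \<le> (\<Prod>l=0..k. rho_coeff A B C \<alpha> X l) * e 0"
    if "\<forall>l\<in>{1..k}. R l \<noteq> 0" for k
  \<comment> \<open>The assumption starts at \<open>l = 1\<close>, so the initial residual may
    vanish; then all errors are 0 and both sides are 0.\<close>
  proof (cases "R 0 = 0")
    case True
    have "e k = 0" for k
      using True zero stop by (induction k) auto
    then show ?thesis by simp
  next
    case False
    from that show ?thesis
    proof (induction k)
      case 0
      then show ?case using rho[OF False] by simp
    next
      case (Suc k)
      have nz: "R (Suc k) \<noteq> 0" using Suc.prems by simp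
      let ?\<rho> = "rho_coeff A B C \<alpha> X"
      have le: "e (Suc (Suc k)) \<le> ?\<rho> (Suc k) * e (Suc k)"
        by (rule rho[OF nz])
      have "0 < e (Suc k)" and "0 \<le> e (Suc (Suc k))"
        using nz zero[of "Suc k"] by (auto simp: e_def)
      \<comment> \<open>The sign is read off the estimate itself: a negative factor times a positive
        error could not bound a nonnegative one. It is needed to multiply the induction
        hypothesis.\<close>
      with le have "0 \<le> ?\<rho> (Suc k)"
        by (metis order_trans zero_le_mult_iff not_le)
      then have "?\<rho> (Suc k) * e (Suc k) \<le> ?\<rho> (Suc k) * ((\<Prod>l=0..k. ?\<rho> l) * e 0)"
        using Suc by (intro mult_left_mono) auto
      with le show ?case by (simp add: mult_ac)
    qed
  qed
  show ?thesis
    using least_norm_solution_characterization[OF sol] Z conv rate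
    unfolding e_def R_def Z_def[symmetric] by blast
qed

end
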